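(* Let $T$ be a tree with $\mu(T)=m$. Then the value of the stripe-game on $T$ with Minimizer responding (and Maximizer initiating) is at least $\lceil m/2\rceil$. Moreover this bound is sharp: for every positive integer $m$ there is a tree $T$ with $\mu(T)=m$ for which the value of the stripe-game with Minimizer responding equals $\lceil m/2\rceil$.
   Context: Graphs are finite, simple and undirected. $P_3$ is the path on three vertices; copies of $P_3$ in a graph are subgraphs, not necessarily induced. A $P_3$-packing of $G$ is a collection of vertex-disjoint copies of $P_3$ in $G$, and $\mu(G)$ is the maximum size (number of copies) of a $P_3$-packing of $G$. The stripe-game on a graph $G$ is played by two players, Maximizer and Minimizer; throughout the game one of them is the initiator and the other is the responder. In each round, the initiator chooses a vertex $v$ of the current graph such that the current graph contains at least one copy of $P_3$ with $v$ as an end-vertex; the responder then chooses one copy of $P_3$ in the current graph with $v$ as an end-vertex; the three vertices of that copy are removed, and the next round is played on the subgraph induced by the remaining vertices. The game ends when the remaining graph contains no copy of $P_3$. Maximizer tries to maximize, and Minimizer tries to minimize, the number of copies of $P_3$ taken. The value of the game is the number of copies taken under optimal play by both players. *)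

theory Defs
  imports Complex_Main "Graph_Theory.Digraph_Component"
begin

text \<open>
  Finite simple undirected graphs are the \<^locale>\<open>graph\<close>s of \<^theory>\<open>Graph_Theory.Digraph\<close>: finite
  symmetric digraphs without loops and multiple arcs, one undirected edge being a pair of
  opposite arcs. In such a digraph the closed walk a, b, a along one edge counts as a
  \<^const>\<open>pre_digraph.cycle\<close>, so the library's \<^const>\<open>tree\<close> is unsuitable. As there are no loops and
  no multiple arcs, the cycles of the undirected graph are the cycles of length at least 3.
\<close>

definition undirected_tree :: "('a, 'b) pre_digraph \<Rightarrow> bool" where
  "undirected_tree T \<longleftrightarrow>
     graph T \<and> Digraph_Component.connected T \<and>
     \<not> (\<exists>p. pre_digraph.cycle T p \<and> length p \<ge> 3)"

definition is_P3 :: "'a \<Rightarrow> 'a \<Rightarrow> 'a \<Rightarrow> ('a, 'b) pre_digraph \<Rightarrow> bool" where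
  "is_P3 a b c H \<longleftrightarrow>
     distinct [a, b, c] \<and> verts H = {a, b, c} \<and>
     arcs_ends H = {(a, b), (b, a), (b, c), (c, b)}"

definition P3_copies :: "('a, 'b) pre_digraph \<Rightarrow> ('a, 'b) pre_digraph set" where
  "P3_copies G = {H. subgraph H G \<and> (\<exists>a b c. is_P3 a b c H)}"

definition P3_copies_ending_at :: "('a, 'b) pre_digraph \<Rightarrow> 'a \<Rightarrow> ('a, 'b) pre_digraph set" where
  "P3_copies_ending_at G v = {H. subgraph H G \<and> (\<exists>b c. is_P3 v b c H)}"

definition P3_packing :: "('a, 'b) pre_digraph \<Rightarrow> ('a, 'b) pre_digraph set \<Rightarrow> bool" where
  "P3_packing G P \<longleftrightarrow>
     P \<subseteq> P3_copies G \<and> (\<forall>H\<in>P. \<forall>K\<in>P. H \<noteq> K \<longrightarrow> verts H \<inter> verts K = {})"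

definition packing_number :: "('a, 'b) pre_digraph \<Rightarrow> nat" where
  "packing_number G = Max {card P | P. P3_packing G P}"

lemma finite_P3_copies:
  assumes "fin_digraph G"
  shows "finite (P3_copies G)"
proof -
  interpret fin_digraph G by fact
  have "H \<in> (\<lambda>(V, A). \<lparr>verts = V, arcs = A, tail = tail G, head = head G\<rparr>) `
      (Pow (verts G) \<times> Pow (arcs G))" if "H \<in> P3_copies G" for H
    using that
    by (intro image_eqI[of _ _ "(verts H, arcs H)"])
       (auto simp: P3_copies_def subgraph_def compatible_def)
  then have "P3_copies G \<subseteq> (\<lambda>(V, A). \<lparr>verts = V, arcs = A, tail = tail G, head = head G\<rparr>) `
      (Pow (verts G) \<times> Pow (arcs G))"
    by blast
  then show ?thesis
    by (rule finite_subset) simp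
qed

lemma P3_copies_ending_at_subset: "P3_copies_ending_at G v \<subseteq> P3_copies G"
  by (auto simp: P3_copies_ending_at_def P3_copies_def)

definition initiator_moves :: "('a, 'b) pre_digraph \<Rightarrow> 'a set" where
  "initiator_moves G = {v \<in> verts G. P3_copies_ending_at G v \<noteq> {}}"

definition remove_copy :: "('a, 'b) pre_digraph \<Rightarrow> ('a, 'b) pre_digraph \<Rightarrow> ('a, 'b) pre_digraph" where
  "remove_copy G H = G \<restriction> (verts G - verts H)"

datatype player = Maximizer | Minimizer

fun opponent :: "player \<Rightarrow> player" where
  "opponent Maximizer = Minimizer"
| "opponent Minimizer = Maximizer"

fun best_outcome :: "player \<Rightarrow> nat set \<Rightarrow> nat" where
  "best_outcome Maximizer X = Max X"
| "best_outcome Minimizer X = Min X"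

text \<open>
  Minimax value of the game with responder \<open>r\<close> on \<open>G\<close>. In the recursive case both sets of
  options are finite and nonempty; the value for infinite \<open>G\<close> is a dummy.
\<close>

function stripe_value :: "player \<Rightarrow> ('a, 'b) pre_digraph \<Rightarrow> nat" where
  "stripe_value r G =
     (if infinite (verts G) \<or> initiator_moves G = {} then 0
      else best_outcome (opponent r)
        ((\<lambda>v. best_outcome r
           ((\<lambda>H. 1 + stripe_value r (remove_copy G H)) ` P3_copies_ending_at G v))
         ` initiator_moves G))"
  by pat_completeness auto
termination
proof (relation "measure (\<lambda>(r, G). card (verts G))", goal_cases)
  case (2 r G v H)
  then have "v \<in> verts H" "v \<in> verts G" "finite (verts G)"
    by (auto simp: P3_copies_ending_at_def is_P3_def initiator_moves_def)
  then show ?case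
    by (auto simp: remove_copy_def intro!: psubset_card_mono)
qed auto

declare stripe_value.simps [simp del]

end

theory Submission
  imports Defs
begin

text \<open>
  The lower bound rests on one observation about a leaf v with neighbour u. Every copy of the
  path that contains v also contains u, because a leaf can only be left through u. So the
  responder's answer to v has the form {v, u, x}, and a member of a packing that meets this set
  contains u or x; by disjointness there are at most two such members. If Maximizer always
  initiates with a leaf, each round costs at most 2 of the packing number
  (\<open>packing_number_le_remove_copy_leaf\<close>), so at least half of it is realised as rounds. The strategy
  is available as long as a copy exists: an end of a longest path in a forest is a leaf, and it
  ends a copy once the path has two edges (\<open>forest_leaf_ends_P3\<close>).

  For sharpness take a caterpillar: a path of centres, each carrying two leaves. The packing number
  is the number of centres. Group the centres into consecutive pairs. Whatever vertex
  Maximizer offers, the pair that it belongs to is intact, and Minimizer can answer with a copy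
  that contains both centres of that pair and touches no other pair; what is left of the pair is a
  set of isolated leaves (\<open>caterpillar_response\<close>). So the game lasts at most one round per
  pair (\<open>stripe_value_caterpillar_le\<close>). For an odd packing number m, take m + 1 centres but
  omit one leaf of the last centre. The response strategy never uses that leaf, while the
  caterpillar has only 3m + 2 vertices, too few for m + 1 disjoint copies.
\<close>

section \<open>Copies of the path on three vertices\<close>

lemma P3_copy_exists:
  assumes "graph G" and "distinct [a, b, c]" and "a \<rightarrow>\<^bsub>G\<^esub> b" and "b \<rightarrow>\<^bsub>G\<^esub> c"
  obtains H where "subgraph H G" and "is_P3 a b c H"
proof -
  interpret graph G by fact
  define H where "H = \<lparr>verts = {a, b, c},
    arcs = {e \<in> arcs G. (tail G e, head G e) \<in> {(a, b), (b, a), (b, c), (c, b)}},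
    tail = tail G, head = head G\<rparr>"
  have "b \<rightarrow>\<^bsub>G\<^esub> a" "c \<rightarrow>\<^bsub>G\<^esub> b"
    using assms(3,4) by (auto dest: graph_symmetric)
  then have "arcs_ends H = {(a, b), (b, a), (b, c), (c, b)}"
    using assms(3,4) unfolding arcs_ends_conv H_def by (auto simp: image_iff)
  then have "is_P3 a b c H"
    using assms(2) by (simp add: is_P3_def H_def)
  moreover have "wf_digraph H"
    by unfold_locales (auto simp: H_def)
  then have "subgraph H G"
    using assms(3,4) wf_digraph
    by (auto simp: subgraph_def compatible_def H_def dest: adj_in_verts)
  ultimately show thesis using that by blast
qed

lemma P3_copy_adjacent:
  assumes "subgraph H G" and "is_P3 a b c H"
  shows "distinct [a, b, c]" and "verts H = {a, b, c}"
    and "a \<rightarrow>\<^bsub>G\<^esub> b" and "b \<rightarrow>\<^bsub>G\<^esub> c" and "b \<rightarrow>\<^bsub>G\<^esub> a" and "c \<rightarrow>\<^bsub>G\<^esub> b"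
  using assms arcs_ends_mono[OF assms(1)] by (auto simp: is_P3_def)

lemma initiator_movesE:
  assumes "v \<in> initiator_moves G"
  obtains b c where "distinct [v, b, c]" and "v \<rightarrow>\<^bsub>G\<^esub> b" and "b \<rightarrow>\<^bsub>G\<^esub> c"
proof -
  from assms obtain H b c where H: "subgraph H G" "is_P3 v b c H"
    by (auto simp: initiator_moves_def P3_copies_ending_at_def)
  show thesis
    using P3_copy_adjacent(1,3,4)[OF H] by (rule that)
qed

lemma initiator_movesI:
  assumes "graph G" and "distinct [v, b, c]" and "v \<rightarrow>\<^bsub>G\<^esub> b" and "b \<rightarrow>\<^bsub>G\<^esub> c"
  shows "v \<in> initiator_moves G"
proof -
  interpret graph G by fact
  from assms obtain H where "subgraph H G" "is_P3 v b c H"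
    by (rule P3_copy_exists)
  with assms(3) show ?thesis
    by (auto simp: initiator_moves_def P3_copies_ending_at_def dest: adj_in_verts)
qed

section \<open>One round of the game\<close>

lemma finite_P3_copies_ending_at:
  "fin_digraph G \<Longrightarrow> finite (P3_copies_ending_at G v)"
  by (rule finite_subset[OF P3_copies_ending_at_subset finite_P3_copies])

lemma stripe_value_Minimizer_ge:
  assumes "fin_digraph G" and v: "v \<in> initiator_moves G"
    and "\<And>H. H \<in> P3_copies_ending_at G v \<Longrightarrow> k \<le> stripe_value Minimizer (remove_copy G H)"
  shows "k + 1 \<le> stripe_value Minimizer G"
proof -
  interpret fin_digraph G by fact
  have fin: "finite (initiator_moves G)"
    by (rule finite_subset[of _ "verts G"]) (auto simp: initiator_moves_def)
  have "P3_copies_ending_at G v \<noteq> {}"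
    using v by (simp add: initiator_moves_def)
  then have "k + 1 \<le> Min ((\<lambda>H. 1 + stripe_value Minimizer (remove_copy G H)) ` P3_copies_ending_at G v)"
    using assms by (auto simp: finite_P3_copies_ending_at)
  also have "\<dots> \<le> stripe_value Minimizer G"
    using v fin by (subst (2) stripe_value.simps) auto
  finally show ?thesis .
qed

lemma stripe_value_Minimizer_le:
  assumes "fin_digraph G"
    and response: "\<And>v. v \<in> initiator_moves G \<Longrightarrow>
      \<exists>H \<in> P3_copies_ending_at G v. stripe_value Minimizer (remove_copy G H) + 1 \<le> k"
  shows "stripe_value Minimizer G \<le> k"
proof (cases "initiator_moves G = {}")
  case True
  then show ?thesis by (simp add: stripe_value.simps)
next
  case False
  interpret fin_digraph G by fact
  have fin: "finite (initiator_moves G)"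
    by (rule finite_subset[of _ "verts G"]) (auto simp: initiator_moves_def)
  have "Min ((\<lambda>H. 1 + stripe_value Minimizer (remove_copy G H)) ` P3_copies_ending_at G v) \<le> k"
    if v: "v \<in> initiator_moves G" for v
  proof -
    from response[OF v] obtain H where H: "H \<in> P3_copies_ending_at G v"
      "stripe_value Minimizer (remove_copy G H) + 1 \<le> k" by blast
    have "Min ((\<lambda>H. 1 + stripe_value Minimizer (remove_copy G H)) ` P3_copies_ending_at G v)
        \<le> 1 + stripe_value Minimizer (remove_copy G H)"
      using H(1) assms(1) by (intro Min_le) (auto simp: finite_P3_copies_ending_at)
    with H(2) show ?thesis by simp
  qed
  then show ?thesis
    using False fin by (subst stripe_value.simps) auto
qed

section \<open>Packings\<close>

lemma finite_P3_packing_sizes: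
  assumes "fin_digraph G"
  shows "finite {card P | P. P3_packing G P}"
proof -
  have "{card P | P. P3_packing G P} \<subseteq> card ` Pow (P3_copies G)"
    by (auto simp: P3_packing_def)
  then show ?thesis
    by (rule finite_subset) (simp add: finite_P3_copies[OF assms])
qed

lemma card_le_packing_number:
  assumes "fin_digraph G" and "P3_packing G P"
  shows "card P \<le> packing_number G"
  unfolding packing_number_def
  using finite_P3_packing_sizes[OF assms(1)] assms(2) by (intro Max_ge) auto

lemma maximum_packing:
  assumes "fin_digraph G"
  obtains P where "P3_packing G P" and "finite P" and "card P = packing_number G"
proof -
  have "P3_packing G {}"
    by (simp add: P3_packing_def)
  then have "packing_number G \<in> {card P | P. P3_packing G P}"
    unfolding packing_number_def
    by (intro Max_in finite_P3_packing_sizes assms) blast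
  then obtain P where P: "P3_packing G P" "card P = packing_number G"
    by auto
  moreover have "finite P"
    using P(1) finite_P3_copies[OF assms] by (auto simp: P3_packing_def intro: finite_subset)
  ultimately show thesis using that by blast
qed

text \<open>Disjoint copies use three vertices each.\<close>
lemma packing_number_le_card_verts:
  assumes "fin_digraph G"
  shows "3 * packing_number G \<le> card (verts G)"
proof -
  interpret fin_digraph G by fact
  obtain P where P: "P3_packing G P" "finite P" "card P = packing_number G"
    using maximum_packing[OF assms] .
  have copy: "card (verts H) = 3 \<and> finite (verts H) \<and> verts H \<subseteq> verts G" if "H \<in> P" for H
    using P(1) that by (auto simp: P3_packing_def P3_copies_def is_P3_def subgraph_def)
  have "3 * card P = (\<Sum>H\<in>P. card (verts H))"
    using copy by simp
  also have "\<dots> = card (\<Union>H\<in>P. verts H)"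
    using P(1,2) copy
    by (intro card_UN_disjoint[symmetric]) (auto simp: P3_packing_def)
  also have "\<dots> \<le> card (verts G)"
    using copy by (intro card_mono) auto
  finally show ?thesis using P(3) by simp
qed

lemma card_packing_through_vertex_le_1:
  assumes "P3_packing G P"
  shows "card {K \<in> P. x \<in> verts K} \<le> 1"
proof -
  have "card {K \<in> P. x \<in> verts K} \<le> Suc 0" if "finite {K \<in> P. x \<in> verts K}"
    unfolding card_le_Suc0_iff_eq[OF that] using assms by (auto simp: P3_packing_def)
  then show ?thesis
    by (cases "finite {K \<in> P. x \<in> verts K}") auto
qed

text \<open>
  The copy H is {v, u, x} for some x, since it leaves v through u. Packed copies that avoid H
  survive. Those that meet H contain u or x, because one that contains v contains u as well.
\<close>
lemma packing_number_le_remove_copy_leaf: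
  assumes "graph G" and leaf: "\<And>w. v \<rightarrow>\<^bsub>G\<^esub> w \<Longrightarrow> w = u"
    and H: "H \<in> P3_copies_ending_at G v"
  shows "packing_number G \<le> packing_number (remove_copy G H) + 2"
proof -
  interpret graph G by fact
  obtain b x where bx: "subgraph H G" "is_P3 v b x H"
    using H by (auto simp: P3_copies_ending_at_def)
  then have vH: "verts H = {v, u, x}"
    using P3_copy_adjacent[OF bx] leaf by auto
  obtain P where P: "P3_packing G P" "finite P" "card P = packing_number G"
    using maximum_packing[OF fin_digraph] .
  define Q where "Q = {K \<in> P. verts K \<inter> verts H = {}}"
  have Q: "P3_packing (remove_copy G H) Q"
    unfolding P3_packing_def
  proof (intro conjI subsetI ballI impI)
    fix K assume "K \<in> Q"
    then have K: "K \<in> P3_copies G" "verts K \<inter> verts H = {}"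
      using P(1) by (auto simp: Q_def P3_packing_def)
    then have "subgraph K G" by (simp add: P3_copies_def)
    then have "subgraph K (remove_copy G H)"
      using K(2) unfolding remove_copy_def
      by (auto simp: subgraph_def compatible_def wf_digraph_def)
    with K(1) show "K \<in> P3_copies (remove_copy G H)"
      by (auto simp: P3_copies_def)
  next
    fix K L assume "K \<in> Q" "L \<in> Q" "K \<noteq> L"
    then show "verts K \<inter> verts L = {}"
      using P(1) by (auto simp: Q_def P3_packing_def)
  qed
  have through_leaf: "u \<in> verts K" if "K \<in> P" "v \<in> verts K" for K
  proof -
    from P(1) that(1) obtain a b c where K: "subgraph K G" "is_P3 a b c K"
      by (auto simp: P3_packing_def P3_copies_def)
    note K' = P3_copy_adjacent[OF K]
    from that(2) K'(2) consider "v = a" | "v = b" | "v = c" by auto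
    then show ?thesis using K' leaf by cases auto
  qed
  have "P - Q \<subseteq> {K \<in> P. u \<in> verts K} \<union> {K \<in> P. x \<in> verts K}"
    using through_leaf by (auto simp: Q_def vH)
  then have "card (P - Q) \<le> card ({K \<in> P. u \<in> verts K} \<union> {K \<in> P. x \<in> verts K})"
    using P(2) by (intro card_mono) auto
  also have "\<dots> \<le> card {K \<in> P. u \<in> verts K} + card {K \<in> P. x \<in> verts K}"
    by (rule card_Un_le)
  also have "\<dots> \<le> 2"
    using card_packing_through_vertex_le_1[OF P(1), of u]
      card_packing_through_vertex_le_1[OF P(1), of x] by simp
  finally have "card P - card Q \<le> 2"
    using P(2) by (subst (asm) card_Diff_subset) (auto simp: Q_def)
  then have "card P \<le> card Q + 2" by linarith
  also have "card Q \<le> packing_number (remove_copy G H)"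
    using Q by (intro card_le_packing_number)
      (auto simp: remove_copy_def intro: fin_digraph_subgraph induced_imp_subgraph)
  finally show ?thesis using P(3) by simp
qed

section \<open>Forests have leaves that end a path on three vertices\<close>

text \<open>
  As for trees, the bound on the length discards the closed walks a, b, a along a single edge.
\<close>
definition undirected_forest :: "('a, 'b) pre_digraph \<Rightarrow> bool" where
  "undirected_forest G \<longleftrightarrow> graph G \<and> \<not> (\<exists>p. pre_digraph.cycle G p \<and> length p \<ge> 3)"

lemma graph_induce_subgraph:
  assumes "graph G" and "W \<subseteq> verts G"
  shows "graph (G \<restriction> W)"
proof -
  interpret graph G by fact
  have ind: "induced_subgraph (G \<restriction> W) G"
    using assms(2) by blast
  interpret D: digraph "G \<restriction> W"
    using ind by (rule digraphI_induced)
  have "symmetric (G \<restriction> W)"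
    using sym_arcs unfolding symmetric_conv by force
  then show ?thesis by (rule D.graphI)
qed

lemma undirected_forest_induce_subgraph:
  assumes "undirected_forest G" and "W \<subseteq> verts G"
  shows "undirected_forest (G \<restriction> W)"
proof -
  interpret graph G using assms(1) by (simp add: undirected_forest_def)
  have "subgraph (G \<restriction> W) G"
    using assms(2) by (auto intro: induced_imp_subgraph)
  then show ?thesis
    using assms graph_induce_subgraph[of G W] subgraph_cycle
    unfolding undirected_forest_def by blast
qed

text \<open>
  Let v be the first vertex of a longest path and u the second. A further neighbour x of v would
  extend the path if it is off the path, and close a cycle of length at least 3 if it is on it.
\<close>
lemma forest_leaf_ends_P3:
  assumes "undirected_forest G" and "P3_copies G \<noteq> {}"
  obtains v u where "v \<in> initiator_moves G" and "\<forall>w. v \<rightarrow>\<^bsub>G\<^esub> w \<longrightarrow> w = u"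
proof -
  have G: "graph G" using assms(1) by (simp add: undirected_forest_def)
  interpret graph G by fact
  obtain H a b c where H: "subgraph H G" "is_P3 a b c H"
    using assms(2) by (auto simp: P3_copies_def)
  note abc = P3_copy_adjacent[OF H]
  obtain e f where ef: "e \<in> arcs G" "tail G e = a" "head G e = b"
    "f \<in> arcs G" "tail G f = b" "head G f = c"
    using abc(3,4) by (auto elim!: reachableE)
  have "apath a [e, f] c"
    using ef abc(1) by (auto simp: apath_simps)
  then have "\<exists>u w. apath u [e, f] w" by blast
  moreover have "\<forall>p. (\<exists>u w. apath u p w) \<longrightarrow> length p < card (verts G)"
    using length_apath_less by blast
  ultimately have "\<exists>p. (\<exists>v w. apath v p w) \<and>
      (\<forall>q. (\<exists>v w. apath v q w) \<longrightarrow> length q \<le> length p)"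
    by (rule ex_has_greatest_nat)
  then obtain p v w where vp: "apath v p w"
    and longest: "\<And>x q y. apath x q y \<Longrightarrow> length q \<le> length p"
    by metis
  have "length [e, f] \<le> length p"
    using \<open>apath a [e, f] c\<close> by (rule longest)
  then obtain g h r where pgh: "p = g # h # r"
    by (cases p rule: remdups_adj.cases) auto
  define u where "u = head G g"
  have g: "g \<in> arcs G" "tail G g = v" and h: "h \<in> arcs G" "tail G h = u" "head G h \<noteq> v" "u \<noteq> v"
    and "head G h \<noteq> u"
    using vp no_loops unfolding pgh u_def apath_simps by (auto dest: hd_in_awalk_verts)
  then have "v \<in> initiator_moves G"
    by (intro initiator_movesI[OF G, of v u "head G h"])
      (auto simp: u_def dest: in_arcs_imp_in_arcs_ends)
  moreover have "x = u" if x: "v \<rightarrow>\<^bsub>G\<^esub> x" for x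
  proof (rule ccontr)
    assume "x \<noteq> u"
    obtain k where k: "k \<in> arcs G" "tail G k = x" "head G k = v"
      using graph_symmetric[OF x] by (auto elim!: reachableE)
    have "x \<noteq> v" using k no_loops by auto
    show False
    proof (cases "x \<in> set (awalk_verts v p)")
      case False
      then have "apath x (k # p) w"
        using vp k by (simp add: apath_simps)
      then have "length (k # p) \<le> length p" by (rule longest)
      then show False by simp
    next
      case True
      with vp obtain q s where q: "p = q @ s" "awalk v q x"
        using awalk_decomp[of v p w x] by (auto simp: apath_def)
      have "length q \<ge> 2"
      proof (rule ccontr)
        assume "\<not> 2 \<le> length q"
        then have "q = [] \<or> q = [g]"
          using q(1) pgh by (cases q rule: remdups_adj.cases) auto
        then show False
          using q(2) \<open>x \<noteq> u\<close> \<open>x \<noteq> v\<close> by (auto simp: awalk_simps u_def)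
      qed
      moreover have "apath v q (awlast v q)"
        using vp q(1) by (simp add: apath_append_iff)
      then have "distinct (awalk_verts v q)"
        by (simp add: apath_def)
      then have "cycle (k # q)"
        using k q(2) unfolding cycle_def by (intro exI[of _ x]) (auto simp: awalk_simps)
      ultimately show False
        using assms(1) unfolding undirected_forest_def by force
    qed
  qed
  ultimately show thesis using that by blast
qed

text \<open>
  Maximizer initiates with a leaf in every round, so that the packing number drops by at most 2.
  The statement is for forests because removing a copy may disconnect a tree.
\<close>
lemma packing_number_le_twice_stripe_value:
  assumes "undirected_forest G"
  shows "packing_number G \<le> 2 * stripe_value Minimizer G"
  using assms
proof (induction "card (verts G)" arbitrary: G rule: less_induct)
  case less
  have G: "graph G" using less.prems by (simp add: undirected_forest_def)
  interpret graph G by fact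
  show ?case
  proof (cases "P3_copies G = {}")
    case True
    obtain P where "P3_packing G P" "card P = packing_number G"
      using maximum_packing[OF fin_digraph] .
    with True show ?thesis by (auto simp: P3_packing_def)
  next
    case False
    obtain v u where v: "v \<in> initiator_moves G" and leaf: "\<forall>w. v \<rightarrow>\<^bsub>G\<^esub> w \<longrightarrow> w = u"
      using forest_leaf_ends_P3[OF less.prems False] .
    \<comment> \<open>k is \<open>\<lceil>\<mu> / 2\<rceil> - 1\<close> for \<open>\<mu> = packing_number G\<close>, the number of rounds that must still follow\<close>
    define k where "k = (packing_number G - 1) div 2"
    have "k \<le> stripe_value Minimizer (remove_copy G H)" if H: "H \<in> P3_copies_ending_at G v" for H
    proof -
      have "v \<in> verts H" "v \<in> verts G"
        using H v by (auto simp: P3_copies_ending_at_def is_P3_def initiator_moves_def)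
      then have "card (verts (remove_copy G H)) < card (verts G)"
        by (auto simp: remove_copy_def intro!: psubset_card_mono)
      moreover have "undirected_forest (remove_copy G H)"
        unfolding remove_copy_def using less.prems by (rule undirected_forest_induce_subgraph) blast
      ultimately have "packing_number (remove_copy G H) \<le> 2 * stripe_value Minimizer (remove_copy G H)"
        by (rule less.hyps)
      moreover have "packing_number G \<le> packing_number (remove_copy G H) + 2"
        using leaf H by (intro packing_number_le_remove_copy_leaf[OF G]) auto
      ultimately show ?thesis unfolding k_def by linarith
    qed
    then have "k + 1 \<le> stripe_value Minimizer G"
      by (rule stripe_value_Minimizer_ge[OF fin_digraph v])
    then show ?thesis unfolding k_def by linarith
  qed
qed

section \<open>Trees given by parent functions\<close>

definition parent_tree :: "(nat \<Rightarrow> nat) \<Rightarrow> nat \<Rightarrow> (nat, nat \<times> nat) pre_digraph" where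
  "parent_tree par n = \<lparr>verts = {..<n},
     arcs = {(u, v). u < n \<and> v < n \<and> (0 < v \<and> u = par v \<or> 0 < u \<and> v = par u)},
     tail = fst, head = snd\<rparr>"

lemma parent_tree_sel [simp]:
  "verts (parent_tree par n) = {..<n}"
  "tail (parent_tree par n) = fst"
  "head (parent_tree par n) = snd"
  by (simp_all add: parent_tree_def)

lemma arcs_parent_tree:
  "(u, v) \<in> arcs (parent_tree par n) \<longleftrightarrow>
     u < n \<and> v < n \<and> (0 < v \<and> u = par v \<or> 0 < u \<and> v = par u)"
  by (simp add: parent_tree_def)

lemma arcs_ends_parent_tree: "arcs_ends (parent_tree par n) = arcs (parent_tree par n)"
  by (simp add: arcs_ends_conv)

lemma graph_parent_tree:
  assumes "\<And>v. 0 < v \<Longrightarrow> par v < v"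
  shows "graph (parent_tree par n)"
proof
  have "arcs (parent_tree par n) \<subseteq> {..<n} \<times> {..<n}"
    by (auto simp: parent_tree_def)
  then show "finite (arcs (parent_tree par n))"
    by (rule finite_subset) simp
  show "symmetric (parent_tree par n)"
    unfolding symmetric_def arcs_ends_parent_tree by (auto simp: sym_def arcs_parent_tree)
next
  fix e assume "e \<in> arcs (parent_tree par n)"
  then show "tail (parent_tree par n) e \<noteq> head (parent_tree par n) e"
    using assms[of "fst e"] assms[of "snd e"] by (cases e) (auto simp: arcs_parent_tree)
qed (auto simp: parent_tree_def arc_to_ends_def prod_eq_iff)

text \<open>
  On a cycle, both neighbours of the largest vertex are smaller than it, so both are its parent.
  On a cycle of length at least 3 these two neighbours are distinct.
\<close>
lemma parent_tree_no_cycle: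
  assumes par: "\<And>v. 0 < v \<Longrightarrow> par v < v"
    and cycle: "pre_digraph.cycle (parent_tree par n) p" and len: "length p \<ge> 3"
  shows False
proof -
  interpret graph "parent_tree par n" using graph_parent_tree[OF par] .
  obtain u where u: "awalk u p u" "distinct (tl (awalk_verts u p))"
    using cycle unfolding cycle_def by blast
  define l where "l = length p"
  \<comment> \<open>The vertices of the cycle, indexed periodically so that the largest one may sit anywhere.\<close>
  define x where "x i = snd (p ! (i mod l))" for i
  have l: "l \<ge> 3" and "p \<noteq> []" using len by (auto simp: l_def)
  have cas: "cas u p u" and arcs: "set p \<subseteq> arcs (parent_tree par n)"
    using u(1) by (auto simp: awalk_def)
  have inj: "i mod l = j mod l" if "x i = x j" for i j
  proof -
    have "distinct (map snd p)"
      using u(2) \<open>p \<noteq> []\<close> by (simp add: awalk_verts_conv'[OF cas])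
    then show ?thesis
      using that l nth_eq_iff_index_eq[of "map snd p" "i mod l" "j mod l"] \<open>p \<noteq> []\<close>
      by (simp add: x_def l_def)
  qed
  have consecutive: "fst (q ! Suc i) = snd (q ! i)"
    if "cas a q b" "Suc i < length q" for a q b i
    using that
  proof (induction q arbitrary: a i)
    case (Cons e q)
    then show ?case by (cases i; cases q) auto
  qed simp
  have close: "fst (p ! 0) = snd (p ! (l - 1))"
  proof -
    have "fst (hd p) = u" "snd (last p) = u"
      using cas \<open>p \<noteq> []\<close> awlast_if_cas[OF cas] by (auto simp: cas_simp awalk_verts_conv)
    with \<open>p \<noteq> []\<close> show ?thesis
      by (simp add: hd_conv_nth last_conv_nth l_def)
  qed
  have arc: "(x i, x (Suc i)) \<in> arcs (parent_tree par n)" for i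
  proof -
    have "x i = fst (p ! (Suc i mod l))"
    proof (cases "Suc (i mod l) = l")
      case True
      then have "i mod l = l - 1" by simp
      with True show ?thesis using close by (simp add: x_def mod_Suc)
    next
      case False
      then have "Suc (i mod l) < l" using l by (simp add: le_neq_implies_less Suc_le_eq)
      then show ?thesis
        using consecutive[OF cas] False by (simp add: x_def l_def mod_Suc)
    qed
    moreover have "p ! (Suc i mod l) \<in> arcs (parent_tree par n)"
      using \<open>p \<noteq> []\<close> by (intro subsetD[OF arcs] nth_mem) (simp add: l_def)
    ultimately show ?thesis by (simp add: x_def)
  qed
  have "x ` {..<l} \<noteq> {}" using l by (auto simp: lessThan_empty_iff)
  then have "Max (x ` {..<l}) \<in> x ` {..<l}" by (intro Max_in) simp_all
  then obtain i where i: "i < l" "x i = Max (x ` {..<l})" by auto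
  have maximal: "x j \<le> x i" for j
  proof -
    have "x j = x (j mod l)" by (simp add: x_def)
    also have "\<dots> \<in> x ` {..<l}" using l by simp
    finally show ?thesis using i(2) by simp
  qed
  \<comment> \<open>j is the cyclic predecessor of i; adding l keeps the subtraction from being truncated\<close>
  define j where "j = i + l - 1"
  have j: "Suc j = i + l" using l by (simp add: j_def)
  then have xj: "x (Suc j) = x i" by (simp add: x_def)
  have "x j = par (x i)"
    using arc[of j] maximal[of j] par[of "x j"] unfolding xj arcs_parent_tree by force
  moreover have "x (Suc i) = par (x i)"
    using arc[of i] maximal[of "Suc i"] par[of "x (Suc i)"] unfolding arcs_parent_tree by force
  ultimately have "j mod l = Suc i mod l"
    using inj by simp
  moreover have "j mod l = (if i = 0 then l - 1 else i - 1)"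
    using i(1) l by (auto simp: j_def mod_if)
  ultimately show False
    using i(1) l by (auto simp: mod_Suc split: if_splits)
qed

lemma undirected_tree_parent_tree:
  assumes par: "\<And>v. 0 < v \<Longrightarrow> par v < v" and "0 < n"
  shows "undirected_tree (parent_tree par n)"
proof -
  interpret graph "parent_tree par n" using graph_parent_tree[OF par] .
  have root: "v \<rightarrow>\<^sup>*\<^bsub>parent_tree par n\<^esub> 0" if "v < n" for v
    using that
  proof (induction v rule: less_induct)
    case (less v)
    show ?case
    proof (cases "v = 0")
      case True
      then show ?thesis using less.prems by simp
    next
      case False
      then have "par v < v" using par by simp
      then have "(v, par v) \<in> arcs_ends (parent_tree par n)"
        using False less.prems by (simp add: arcs_ends_parent_tree arcs_parent_tree)
      moreover have "par v \<rightarrow>\<^sup>*\<^bsub>parent_tree par n\<^esub> 0"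
        using less \<open>par v < v\<close> by simp
      ultimately show ?thesis by (rule adj_reachable_trans)
    qed
  qed
  have "u \<rightarrow>\<^sup>*\<^bsub>parent_tree par n\<^esub> v" if "u < n" "v < n" for u v
    using root[OF that(1)] root[OF that(2)] symmetric_reachable[OF sym_arcs] reachable_trans by blast
  then have "Digraph_Component.connected (parent_tree par n)"
    unfolding connected_def using \<open>0 < n\<close>
    by (auto intro!: strongly_connectedI reachable_mk_symmetricI)
  then show ?thesis
    unfolding undirected_tree_def
    using graph_parent_tree[OF par] parent_tree_no_cycle[OF par] by blast
qed

section \<open>The caterpillar\<close>

text \<open>
  The multiples of 3 are the centres, and they form a path. The leaves at the centre \<open>3 * i\<close> are
  \<open>3 * i + 1\<close> and \<open>3 * i + 2\<close>: the parent of v is \<open>v - 3\<close> for a centre and the largest multiple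
  of 3 below v for a leaf, which the formula covers uniformly. The vertices with \<open>v div 6 = b\<close> form
  the block b, which consists of the two centres \<open>6 * b\<close> and \<open>6 * b + 3\<close> with their leaves.
\<close>
definition caterpillar :: "nat \<Rightarrow> (nat, nat \<times> nat) pre_digraph" where
  "caterpillar n = parent_tree (\<lambda>v. 3 * ((v - 1) div 3)) n"

lemma caterpillar_parent_less: "0 < v \<Longrightarrow> 3 * ((v - 1) div 3) < v" for v :: nat
  by presburger

lemma undirected_tree_caterpillar: "0 < n \<Longrightarrow> undirected_tree (caterpillar n)"
  unfolding caterpillar_def by (intro undirected_tree_parent_tree caterpillar_parent_less)

lemma graph_caterpillar: "graph (caterpillar n)"
  unfolding caterpillar_def by (intro graph_parent_tree caterpillar_parent_less)

lemma verts_caterpillar [simp]: "verts (caterpillar n) = {..<n}"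
  by (simp add: caterpillar_def)

lemma caterpillar_adjacent:
  "u \<rightarrow>\<^bsub>caterpillar n\<^esub> v \<longleftrightarrow> u < n \<and> v < n \<and>
     (0 < v \<and> u = 3 * ((v - 1) div 3) \<or> 0 < u \<and> v = 3 * ((u - 1) div 3))"
  by (simp add: caterpillar_def arcs_ends_parent_tree arcs_parent_tree)

text \<open>
  Counting vertices gives the upper bound. It is attained by the copies that consist of a centre
  and its two leaves.
\<close>
lemma packing_number_caterpillar: "packing_number (caterpillar n) = n div 3"
proof (rule antisym)
  interpret graph "caterpillar n" by (rule graph_caterpillar)
  show "packing_number (caterpillar n) \<le> n div 3"
    using packing_number_le_card_verts[OF fin_digraph] by simp
  have "\<exists>H. subgraph H (caterpillar n) \<and> is_P3 (3 * i + 1) (3 * i) (3 * i + 2) H"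
    if "i < n div 3" for i
  proof -
    have "3 * i + 2 < n" using that by presburger
    then have "(3 * i + 1) \<rightarrow>\<^bsub>caterpillar n\<^esub> (3 * i)" "(3 * i) \<rightarrow>\<^bsub>caterpillar n\<^esub> (3 * i + 2)"
      by (simp_all add: caterpillar_adjacent) presburger
    then show ?thesis
      using P3_copy_exists[OF graph_caterpillar, of "3 * i + 1" "3 * i" "3 * i + 2" n] by force
  qed
  then obtain H where H: "subgraph (H i) (caterpillar n)" "is_P3 (3 * i + 1) (3 * i) (3 * i + 2) (H i)"
    if "i < n div 3" for i
    by metis
  have verts_H: "verts (H i) = {3 * i + 1, 3 * i, 3 * i + 2}" if "i < n div 3" for i
    using H(2)[OF that] by (simp add: is_P3_def)
  then have index: "x div 3 = i" if "i < n div 3" "x \<in> verts (H i)" for i x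
    using that by auto
  then have disj: "i = j" if "i < n div 3" "j < n div 3" "verts (H i) \<inter> verts (H j) \<noteq> {}" for i j
    using that by blast
  have "inj_on H {..<n div 3}"
  proof (rule inj_onI)
    fix i j assume ij: "i \<in> {..<n div 3}" "j \<in> {..<n div 3}" "H i = H j"
    then have "3 * i \<in> verts (H i)" using verts_H[of i] by simp
    then have "verts (H i) \<inter> verts (H j) \<noteq> {}" using ij(3) by auto
    then show "i = j" using disj ij(1,2) by blast
  qed
  then have "card (H ` {..<n div 3}) = n div 3"
    by (simp add: card_image)
  moreover have "P3_packing (caterpillar n) (H ` {..<n div 3})"
    using H disj unfolding P3_packing_def P3_copies_def by blast
  ultimately show "n div 3 \<le> packing_number (caterpillar n)"
    using card_le_packing_number[OF fin_digraph] by metis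
qed

text \<open>
  Minimizer's answer inside a block: it takes both centres of the block of v. The answers use no
  leaf other than v, \<open>6 * b + 1\<close> and \<open>6 * b + 4\<close>, so \<open>6 * b + 5\<close> may be absent.
\<close>
lemma caterpillar_response:
  assumes b: "b = v div 6" and n: "6 * b + 5 \<le> n" and v: "v < n"
  obtains y z where "distinct [v, y, z]" and "v \<rightarrow>\<^bsub>caterpillar n\<^esub> y" and "y \<rightarrow>\<^bsub>caterpillar n\<^esub> z"
    and "{6 * b, 6 * b + 3} \<subseteq> {v, y, z}" and "y < n" and "z < n" and "y div 6 = b" and "z div 6 = b"
proof -
  have "v \<in> {6*b, 6*b+1, 6*b+2, 6*b+3, 6*b+4, 6*b+5}"
    unfolding b by simp presburger
  then consider "v = 6*b" | "v = 6*b+1" | "v = 6*b+2" | "v = 6*b+3" | "v = 6*b+4" | "v = 6*b+5"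
    by blast
  then show thesis
  proof cases
    case 1
    have "v \<rightarrow>\<^bsub>caterpillar n\<^esub> (6*b+3)" "(6*b+3) \<rightarrow>\<^bsub>caterpillar n\<^esub> (6*b+4)"
      using n v unfolding caterpillar_adjacent 1 by auto
    then show thesis
      using 1 n by (intro that[of "6*b+3" "6*b+4"]) auto
  next
    case 2
    have "v \<rightarrow>\<^bsub>caterpillar n\<^esub> (6*b)" "(6*b) \<rightarrow>\<^bsub>caterpillar n\<^esub> (6*b+3)"
      using n v unfolding caterpillar_adjacent 2 by auto
    then show thesis
      using 2 n by (intro that[of "6*b" "6*b+3"]) auto
  next
    case 3
    have "v \<rightarrow>\<^bsub>caterpillar n\<^esub> (6*b)" "(6*b) \<rightarrow>\<^bsub>caterpillar n\<^esub> (6*b+3)"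
      using n v unfolding caterpillar_adjacent 3 by auto
    then show thesis
      using 3 n by (intro that[of "6*b" "6*b+3"]) auto
  next
    case 4
    have "v \<rightarrow>\<^bsub>caterpillar n\<^esub> (6*b)" "(6*b) \<rightarrow>\<^bsub>caterpillar n\<^esub> (6*b+1)"
      using n v unfolding caterpillar_adjacent 4 by auto
    then show thesis
      using 4 n by (intro that[of "6*b" "6*b+1"]) auto
  next
    case 5
    have "v \<rightarrow>\<^bsub>caterpillar n\<^esub> (6*b+3)" "(6*b+3) \<rightarrow>\<^bsub>caterpillar n\<^esub> (6*b)"
      using n v unfolding caterpillar_adjacent 5 by auto
    then show thesis
      using 5 n by (intro that[of "6*b+3" "6*b"]) auto
  next
    case 6
    have "v \<rightarrow>\<^bsub>caterpillar n\<^esub> (6*b+3)" "(6*b+3) \<rightarrow>\<^bsub>caterpillar n\<^esub> (6*b)"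
      using n v unfolding caterpillar_adjacent 6 by auto presburger
    then show thesis
      using 6 n by (intro that[of "6*b+3" "6*b"]) auto
  qed
qed

text \<open>
  The invariant of Minimizer's strategy: the blocks in B are untouched, and no centre of any other
  block is left. A vertex that ends a copy is a centre or adjacent to its own centre, so it lies
  in a block of B, and the answer removes exactly that block from B.
\<close>
lemma stripe_value_caterpillar_le:
  assumes "finite B" and n: "\<And>b. b \<in> B \<Longrightarrow> 6 * b + 5 \<le> n"
    and "W \<subseteq> {..<n}"
    and intact: "\<And>v. v < n \<Longrightarrow> v div 6 \<in> B \<Longrightarrow> v \<in> W"
    and centres: "\<And>v. v \<in> W \<Longrightarrow> 3 dvd v \<Longrightarrow> v div 6 \<in> B"
  shows "stripe_value Minimizer (caterpillar n \<restriction> W) \<le> card B"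
  using assms
proof (induction "card B" arbitrary: B W rule: less_induct)
  case less
  interpret G: graph "caterpillar n \<restriction> W"
    using less.prems(3) by (intro graph_induce_subgraph graph_caterpillar) simp
  have adj: "u \<rightarrow>\<^bsub>caterpillar n \<restriction> W\<^esub> v \<longleftrightarrow> u \<in> W \<and> v \<in> W \<and> u \<rightarrow>\<^bsub>caterpillar n\<^esub> v" for u v
    by (auto simp: arcs_ends_conv image_iff)
  show ?case
  proof (rule stripe_value_Minimizer_le[OF G.fin_digraph])
    fix v assume "v \<in> initiator_moves (caterpillar n \<restriction> W)"
    then obtain x where "v \<rightarrow>\<^bsub>caterpillar n \<restriction> W\<^esub> x"
      by (rule initiator_movesE)
    then have x: "v \<in> W" "x \<in> W" "v \<rightarrow>\<^bsub>caterpillar n\<^esub> x"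
      by (simp_all add: adj)
    have vB: "v div 6 \<in> B"
    proof (cases "3 dvd v")
      case True
      with less.prems(5) x(1) show ?thesis by blast
    next
      case False
      have "x = 3 * ((v - 1) div 3)"
        using x(3) False by (auto simp: caterpillar_adjacent)
      also have "(v - 1) div 3 = v div 3"
        using False by presburger
      finally have "3 dvd x" "x div 6 = v div 6" by presburger+
      with less.prems(5)[OF x(2)] show ?thesis by simp
    qed
    define b where "b = v div 6"
    obtain y z where yz: "distinct [v, y, z]" "v \<rightarrow>\<^bsub>caterpillar n\<^esub> y" "y \<rightarrow>\<^bsub>caterpillar n\<^esub> z"
      "{6 * b, 6 * b + 3} \<subseteq> {v, y, z}" "y < n" "z < n" "y div 6 = b" "z div 6 = b"
      by (rule caterpillar_response[OF b_def, of n]) (use less.prems x vB in \<open>auto simp: b_def\<close>)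
    have "y \<in> W" "z \<in> W"
      using less.prems(4) yz vB by (auto simp: b_def)
    then obtain H where H: "subgraph H (caterpillar n \<restriction> W)" "is_P3 v y z H"
      using P3_copy_exists[OF G.graph_axioms, of v y z] yz x(1) by (auto simp: adj)
    have removed: "remove_copy (caterpillar n \<restriction> W) H = caterpillar n \<restriction> (W - {v, y, z})"
      using H(2) by (auto simp: remove_copy_def is_P3_def induce_subgraph_def)
    have cardB: "card (B - {b}) + 1 = card B"
      using vB less.prems(1) card_Suc_Diff1[of B b] by (simp add: b_def)
    have "stripe_value Minimizer (caterpillar n \<restriction> (W - {v, y, z})) \<le> card (B - {b})"
    proof (rule less.hyps)
      show "card (B - {b}) < card B" using cardB by simp
      show "finite (B - {b})" "W - {v, y, z} \<subseteq> {..<n}" using less.prems by auto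
      show "6 * b' + 5 \<le> n" if "b' \<in> B - {b}" for b' using less.prems(2) that by blast
      show "u \<in> W - {v, y, z}" if "u < n" "u div 6 \<in> B - {b}" for u
        using that less.prems(4) yz(7,8) by (auto simp: b_def)
      show "u div 6 \<in> B - {b}" if u: "u \<in> W - {v, y, z}" "3 dvd u" for u
      proof -
        have "u \<noteq> 6 * b" "u \<noteq> 6 * b + 3" using u(1) yz(4) by auto
        moreover obtain t where "u = 3 * t" using u(2) by blast
        ultimately have "u div 6 \<noteq> b" by auto
        then show ?thesis using less.prems(5) u by blast
      qed
    qed
    then show "\<exists>H \<in> P3_copies_ending_at (caterpillar n \<restriction> W) v.
        stripe_value Minimizer (remove_copy (caterpillar n \<restriction> W) H) + 1 \<le> card B"
      using H removed cardB by (intro bexI[of _ H]) (auto simp: P3_copies_ending_at_def)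
  qed
qed

lemma exists_tree_with_small_stripe_value:
  assumes "m \<ge> 1"
  shows "\<exists>T :: (nat, nat \<times> nat) pre_digraph. undirected_tree T \<and> packing_number T = m \<and>
    2 * stripe_value Minimizer T \<le> m + 1"
proof -
  \<comment> \<open>k blocks, complete for even m; for odd m the last leaf is omitted, so that \<open>n = 6 * k - 1\<close>\<close>
  define n where "n = 3 * m + 2 * (m mod 2)"
  define k where "k = (m + 1) div 2"
  obtain j where "m = 2 * j \<or> m = 2 * j + 1"
    by (metis evenE oddE)
  then have n: "6 * k \<le> n + 1" "n \<le> 6 * k" and m: "n div 3 = m"
    by (auto simp: n_def k_def)
  have "caterpillar n \<restriction> {..<n} = caterpillar n"
    by (auto simp: induce_subgraph_def caterpillar_def parent_tree_def)
  moreover have "stripe_value Minimizer (caterpillar n \<restriction> {..<n}) \<le> card {..<k}"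
  proof (rule stripe_value_caterpillar_le)
    show "6 * b + 5 \<le> n" if "b \<in> {..<k}" for b using that n by simp
    show "v div 6 \<in> {..<k}" if "v \<in> {..<n}" "3 dvd v" for v
      using that n by (simp add: less_mult_imp_div_less mult.commute)
  qed auto
  ultimately have "stripe_value Minimizer (caterpillar n) \<le> k" by simp
  then have "2 * stripe_value Minimizer (caterpillar n) \<le> m + 1"
    unfolding k_def by presburger
  then show ?thesis
    using undirected_tree_caterpillar[of n] packing_number_caterpillar[of n] m assms
    by (intro exI[of _ "caterpillar n"]) (simp add: n_def)
qed

theorem lemma7:
  shows "(\<forall>(T :: ('a, 'b) pre_digraph) m. undirected_tree T \<and> packing_number T = m \<longrightarrow>
            int (stripe_value Minimizer T) \<ge> \<lceil>real m / 2\<rceil>)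
       \<and> (\<forall>m::nat. m \<ge> 1 \<longrightarrow>
            (\<exists>T :: (nat, nat \<times> nat) pre_digraph. undirected_tree T \<and> packing_number T = m \<and>
               int (stripe_value Minimizer T) = \<lceil>real m / 2\<rceil>))"
proof (intro conjI allI impI; (elim conjE)?)
  have forest: "undirected_tree T \<Longrightarrow> undirected_forest T" for T :: "('c, 'd) pre_digraph"
    by (simp add: undirected_tree_def undirected_forest_def)
  {
    fix T :: "('a, 'b) pre_digraph" and m
    assume "undirected_tree T" "packing_number T = m"
    then have "m \<le> 2 * stripe_value Minimizer T"
      using packing_number_le_twice_stripe_value[of T] forest[of T] by simp
    then show "int (stripe_value Minimizer T) \<ge> \<lceil>real m / 2\<rceil>"
      by (simp add: ceiling_le_iff)
  }
  fix m :: nat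
  assume "m \<ge> 1"
  then obtain T :: "(nat, nat \<times> nat) pre_digraph"
    where T: "undirected_tree T" "packing_number T = m" "2 * stripe_value Minimizer T \<le> m + 1"
    using exists_tree_with_small_stripe_value by blast
  moreover have "m \<le> 2 * stripe_value Minimizer T"
    using T packing_number_le_twice_stripe_value[of T] forest[of T] by simp
  ultimately have "int (stripe_value Minimizer T) = \<lceil>real m / 2\<rceil>"
    by (intro ceiling_unique[symmetric]) linarith+
  with T show "\<exists>T :: (nat, nat \<times> nat) pre_digraph. undirected_tree T \<and> packing_number T = m \<and>
      int (stripe_value Minimizer T) = \<lceil>real m / 2\<rceil>"
    by blast
qed

end
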